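(* For every conflict-free event structure $(E,\mathrm{en})$ there exists a dependency event structure $(\widetilde E,\widetilde{\mathrm{en}})$ such that $\mathcal F(E)\cong\mathcal F(\widetilde E)$ (as posets).
   Context: $P(A)$ denotes the power set of $A$. A conflict-free event structure (CFES) is a pair $(E,\mathrm{en})$ with $E$ a finite set and $\mathrm{en}:E\to P(P(E))$ such that $X\in\mathrm{en}(e)$ and $X\subseteq Y\subseteq E$ imply $Y\in\mathrm{en}(e)$. A configuration is a subset $X\subseteq E$ such that for every $e\in X$ there is a finite sequence $e_0,\dots,e_n\in X$ with $e_n=e$ and $\{e_0,\dots,e_{i-1}\}\in\mathrm{en}(e_i)$ for all $0\le i\le n$ (for $i=0$ this set is empty). $\mathcal F(E)$ is the poset of configurations of $(E,\mathrm{en})$ ordered by inclusion. $X$ is a minimal enabling set for $e$, written $X\in\mathrm{en}_0(e)$, if $X\in\mathrm{en}(e)$ and $Y\subseteq X$, $Y\in\mathrm{en}(e)$ imply $Y=X$. A dependency event structure is a CFES that is acyclic ($X\in\mathrm{en}_0(e)$ implies $e\notin X$), nonsingular ($\mathrm{en}(e)\neq\varnothing$ for all $e$) and has configurable minimal enabling sets (every $X\in\mathrm{en}_0(e)$ is a configuration, for all $e$). *)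

theory Defs
  imports Main
begin

text \<open>The enabling map \<open>en : E \<rightarrow> P(P(E))\<close> is a total function on the ambient type;
  its values outside \<open>E\<close> are unconstrained and never used.\<close>

locale cfes =
  fixes E :: "'a set" and en :: "'a \<Rightarrow> 'a set set"
  assumes finite_events: "finite E"
    and en_subset: "e \<in> E \<Longrightarrow> en e \<subseteq> Pow E"
    and en_upward: "\<lbrakk>e \<in> E; X \<in> en e; X \<subseteq> Y; Y \<subseteq> E\<rbrakk> \<Longrightarrow> Y \<in> en e"

text \<open>The list \<open>es\<close> is the sequence \<open>e\<^sub>0, \<dots>, e\<^sub>n\<close> (with \<open>n = length es - 1\<close>), so that
  \<open>set (take i es) = {e\<^sub>0, \<dots>, e\<^sub>i\<^sub>-\<^sub>1}\<close>. Repetitions are allowed.\<close>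

definition configuration :: "'a set \<Rightarrow> ('a \<Rightarrow> 'a set set) \<Rightarrow> 'a set \<Rightarrow> bool" where
  "configuration E en X \<longleftrightarrow>
     X \<subseteq> E \<and>
     (\<forall>e\<in>X. \<exists>es. es \<noteq> [] \<and> set es \<subseteq> X \<and> last es = e \<and>
        (\<forall>i<length es. set (take i es) \<in> en (es ! i)))"

definition configurations :: "'a set \<Rightarrow> ('a \<Rightarrow> 'a set set) \<Rightarrow> 'a set set" where
  "configurations E en = {X. configuration E en X}"

definition min_enabling :: "('a \<Rightarrow> 'a set set) \<Rightarrow> 'a \<Rightarrow> 'a set set" where
  "min_enabling en e = {X \<in> en e. \<forall>Y. Y \<subseteq> X \<and> Y \<in> en e \<longrightarrow> Y = X}"

locale dependency_event_structure = cfes +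
  assumes acyclic: "\<lbrakk>e \<in> E; X \<in> min_enabling en e\<rbrakk> \<Longrightarrow> e \<notin> X"
    and nonsingular: "e \<in> E \<Longrightarrow> en e \<noteq> {}"
    and configurable: "\<lbrakk>e \<in> E; X \<in> min_enabling en e\<rbrakk> \<Longrightarrow> configuration E en X"

text \<open>Subsets of a type in class \<^class>\<open>order\<close> are viewed as posets with the induced order;
  for sets of sets this order is inclusion.\<close>

definition poset_isomorphic :: "'a::order set \<Rightarrow> 'b::order set \<Rightarrow> bool" where
  "poset_isomorphic A B \<longleftrightarrow>
     (\<exists>f. bij_betw f A B \<and> (\<forall>x\<in>A. \<forall>y\<in>A. x \<le> y \<longleftrightarrow> f x \<le> f y))"

end

theory Submission
  imports Defs
begin

text \<open>Only the events that occur in some configuration matter for the poset of configurations,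
  and for such an event \<open>e\<close> only those enabling sets matter that contain an enabling
  configuration avoiding \<open>e\<close>: in a sequence witnessing that \<open>e\<close> is reached, the events that
  precede the first occurrence of \<open>e\<close> form exactly such a configuration. Discarding all other
  events and enabling sets therefore leaves the configurations unchanged
  (\<open>configurations_reduct\<close>). In the structure that remains, a minimal enabling set of \<open>e\<close> is
  itself a configuration avoiding \<open>e\<close>, and every event is enabled by some set; so it is a
  dependency event structure (\<open>dependency_reduct\<close>) with the very same configurations. Only
  numbering the events by natural numbers makes the isomorphism of posets differ from the
  identity (\<open>poset_isomorphic_rename\<close>).\<close>

section \<open>Securing sequences\<close>

definition securing :: "('a \<Rightarrow> 'a set set) \<Rightarrow> 'a list \<Rightarrow> bool" where
  "securing en es \<longleftrightarrow> (\<forall>i<length es. set (take i es) \<in> en (es ! i))"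

lemma configuration_iff_securing:
  "configuration E en X \<longleftrightarrow>
     X \<subseteq> E \<and> (\<forall>e\<in>X. \<exists>es. es \<noteq> [] \<and> set es \<subseteq> X \<and> last es = e \<and> securing en es)"
  by (simp add: configuration_def securing_def)

lemma securing_take:
  assumes "securing en es"
  shows "securing en (take n es)"
  using assms by (auto simp: securing_def min_def)

lemma securing_imp_configuration:
  assumes sec: "securing en es" and sub: "set es \<subseteq> E"
  shows "configuration E en (set es)"
  unfolding configuration_iff_securing
proof (intro conjI ballI)
  show "set es \<subseteq> E" by (fact sub)
next
  fix e assume "e \<in> set es"
  then obtain i where i: "i < length es" "es ! i = e"
    by (auto simp: in_set_conv_nth)
  let ?fs = "take (Suc i) es"
  have "?fs \<noteq> []" "last ?fs = e" using i by (auto simp: take_Suc_conv_app_nth)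
  moreover have "set ?fs \<subseteq> set es" by (rule set_take_subset)
  moreover have "securing en ?fs" using sec by (rule securing_take)
  ultimately show "\<exists>fs. fs \<noteq> [] \<and> set fs \<subseteq> set es \<and> last fs = e \<and> securing en fs"
    by blast
qed

section \<open>The reduction to a dependency event structure\<close>

definition reachable_events :: "'a set \<Rightarrow> ('a \<Rightarrow> 'a set set) \<Rightarrow> 'a set" where
  "reachable_events E en = \<Union> (configurations E en)"

text \<open>The condition \<open>e \<notin> X\<close> makes the reduct acyclic, and the condition that \<open>X\<close> is a
  configuration makes its minimal enabling sets configurable.\<close>

definition reduct :: "'a set \<Rightarrow> ('a \<Rightarrow> 'a set set) \<Rightarrow> 'a \<Rightarrow> 'a set set" where
  "reduct E en e =
     {Y. Y \<subseteq> reachable_events E en \<and>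
         (\<exists>X\<in>en e. configuration E en X \<and> e \<notin> X \<and> X \<subseteq> Y)}"

lemma configuration_subset_reachable:
  assumes "configuration E en X"
  shows "X \<subseteq> reachable_events E en"
  using assms by (auto simp: reachable_events_def configurations_def)

lemma reachable_events_subset: "reachable_events E en \<subseteq> E"
  by (auto simp: reachable_events_def configurations_def configuration_def)

text \<open>An event may be repeated in a securing sequence, and then the events before a later
  occurrence do not form a configuration that avoids it; those before its first occurrence do.\<close>

lemma securing_reduct:
  assumes sec: "securing en es" and sub: "set es \<subseteq> E"
  shows "securing (reduct E en) es"
  unfolding securing_def
proof (intro allI impI)
  fix i assume i: "i < length es"
  define j where "j = (LEAST k. es ! k = es ! i)"
  have j: "es ! j = es ! i" unfolding j_def by (rule LeastI[of _ i]) simp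
  have ji: "j \<le> i" unfolding j_def by (rule Least_le) simp
  have first: "es ! k \<noteq> es ! i" if "k < j" for k
    using that unfolding j_def by (rule not_less_Least)
  have conf: "configuration E en (set (take n es))" for n
    by (rule securing_imp_configuration[OF securing_take[OF sec]])
      (rule order_trans[OF set_take_subset sub])
  have "set (take j es) \<in> en (es ! i)"
    using sec i j ji by (metis securing_def le_less_trans)
  moreover have "es ! i \<notin> set (take j es)"
    using first by (auto simp: in_set_conv_nth)
  moreover have "set (take j es) \<subseteq> set (take i es)"
    using ji by (rule set_take_subset_set_take)
  ultimately show "set (take i es) \<in> reduct E en (es ! i)"
    using conf configuration_subset_reachable[OF conf] unfolding reduct_def by blast
qed

context cfes
begin

lemma securing_of_reduct:
  assumes sec: "securing (reduct E en) es" and sub: "set es \<subseteq> E"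
  shows "securing en es"
  unfolding securing_def
proof (intro allI impI)
  fix i assume i: "i < length es"
  obtain X where X: "X \<in> en (es ! i)" "X \<subseteq> set (take i es)"
    using sec i unfolding securing_def reduct_def by blast
  have "set (take i es) \<subseteq> E"
    by (rule order_trans[OF set_take_subset sub])
  with X i sub show "set (take i es) \<in> en (es ! i)"
    by (meson en_upward nth_mem subsetD)
qed

lemma configurations_reduct:
  "configurations (reachable_events E en) (reduct E en) = configurations E en"
proof -
  have "configuration (reachable_events E en) (reduct E en) X \<longleftrightarrow> configuration E en X" for X
  proof
    assume X: "configuration (reachable_events E en) (reduct E en) X"
    have "X \<subseteq> E"
      using X reachable_events_subset[of E en] by (auto simp: configuration_def)
    with X show "configuration E en X"
      unfolding configuration_iff_securing by (meson order_trans securing_of_reduct)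
  next
    assume X: "configuration E en X"
    have "X \<subseteq> reachable_events E en"
      using X by (rule configuration_subset_reachable)
    with X show "configuration (reachable_events E en) (reduct E en) X"
      unfolding configuration_iff_securing by (meson order_trans securing_reduct)
  qed
  then show ?thesis by (simp add: configurations_def)
qed

text \<open>The configuration inside an enabling set of the reduct is itself enabling, so a minimal
  enabling set coincides with it.\<close>

lemma min_enabling_reduct:
  assumes "X \<in> min_enabling (reduct E en) e"
  shows "configuration E en X" and "e \<notin> X"
proof -
  obtain Z where Z: "Z \<in> en e" "configuration E en Z" "e \<notin> Z" "Z \<subseteq> X"
    using assms unfolding min_enabling_def reduct_def by blast
  have "Z \<in> reduct E en e"
    using Z configuration_subset_reachable[OF Z(2)] unfolding reduct_def by blast
  with Z(4) assms have "Z = X" unfolding min_enabling_def by blast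
  with Z show "configuration E en X" and "e \<notin> X" by simp_all
qed

lemma dependency_reduct:
  "dependency_event_structure (reachable_events E en) (reduct E en)"
proof
  show "finite (reachable_events E en)"
    using reachable_events_subset finite_events by (rule finite_subset)
next
  fix e show "reduct E en e \<subseteq> Pow (reachable_events E en)"
    by (auto simp: reduct_def)
next
  fix e X Y
  assume "X \<in> reduct E en e" "X \<subseteq> Y" "Y \<subseteq> reachable_events E en"
  then show "Y \<in> reduct E en e"
    unfolding reduct_def by blast
next
  fix e X assume "X \<in> min_enabling (reduct E en) e"
  then show "e \<notin> X" by (rule min_enabling_reduct)
next
  fix e X assume "X \<in> min_enabling (reduct E en) e"
  then have "X \<in> configurations E en"
    by (simp add: configurations_def min_enabling_reduct)
  then show "configuration (reachable_events E en) (reduct E en) X"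
    unfolding configurations_reduct[symmetric] by (simp add: configurations_def)
next
  fix e assume "e \<in> reachable_events E en"
  then obtain X where "configuration E en X" "e \<in> X"
    by (auto simp: reachable_events_def configurations_def)
  then obtain es where es: "es \<noteq> []" "set es \<subseteq> E" "last es = e" "securing en es"
    unfolding configuration_iff_securing by blast
  \<comment> \<open>The events before the last position of \<open>es\<close> enable its last event \<open>e\<close>.\<close>
  then have "set (take (length es - 1) es) \<in> reduct E en (es ! (length es - 1))"
    using securing_reduct[OF es(4,2)] unfolding securing_def by simp
  with es show "reduct E en e \<noteq> {}" by (auto simp: last_conv_nth)
qed

end

section \<open>Renaming of events\<close>

definition rename_enabling ::
    "('a \<Rightarrow> 'b) \<Rightarrow> 'a set \<Rightarrow> ('a \<Rightarrow> 'a set set) \<Rightarrow> 'b \<Rightarrow> 'b set set" where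
  "rename_enabling h E en b = (`) h ` en (inv_into E h b)"

lemma image_subset_image_iff_of_inj_on:
  assumes "inj_on h E" "X \<subseteq> E" "Y \<subseteq> E"
  shows "h ` X \<subseteq> h ` Y \<longleftrightarrow> X \<subseteq> Y"
  using assms by (auto simp: inj_on_def subset_iff image_iff) metis

lemma rename_enabling_image:
  assumes "inj_on h E" "e \<in> E"
  shows "rename_enabling h E en (h e) = (`) h ` en e"
  using assms by (simp add: rename_enabling_def)

text \<open>Used for a renaming and for its inverse, this yields that the configurations of the renamed
  structure are exactly the images of configurations.\<close>

lemma configuration_image:
  assumes en': "\<And>e. e \<in> E \<Longrightarrow> (`) h ` en e \<subseteq> en' (h e)"
    and X: "configuration E en X"
  shows "configuration (h ` E) en' (h ` X)"
  unfolding configuration_iff_securing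
proof (intro conjI ballI)
  show "h ` X \<subseteq> h ` E" using X by (auto simp: configuration_def)
next
  fix b assume "b \<in> h ` X"
  then obtain e where e: "e \<in> X" "b = h e" by blast
  then obtain es where es: "es \<noteq> []" "set es \<subseteq> X" "last es = e" "securing en es"
    using X unfolding configuration_iff_securing by blast
  have "securing en' (map h es)"
    unfolding securing_def
  proof (intro allI impI)
    fix i assume "i < length (map h es)"
    then have i: "i < length es" by simp
    have "es ! i \<in> E"
      using i es(2) X nth_mem unfolding configuration_def by blast
    moreover have "set (take i es) \<in> en (es ! i)"
      using es(4) i by (simp add: securing_def)
    ultimately have "h ` set (take i es) \<in> en' (h (es ! i))"
      using en' by blast
    then show "set (take i (map h es)) \<in> en' (map h es ! i)"
      using i by (simp add: take_map)
  qed
  moreover have "map h es \<noteq> []" "set (map h es) \<subseteq> h ` X" "last (map h es) = b"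
    using es e by (auto simp: last_map)
  ultimately show "\<exists>bs. bs \<noteq> [] \<and> set bs \<subseteq> h ` X \<and> last bs = b \<and> securing en' bs"
    by blast
qed

context cfes
begin

lemma inv_image_enabling:
  assumes "inj_on h E" "e \<in> E" "X \<in> en e"
  shows "inv_into E h ` h ` X = X"
  using assms en_subset[of e] by (simp add: inv_into_image_cancel Pow_def subset_iff)

lemma cfes_rename:
  assumes h: "inj_on h E"
  shows "cfes (h ` E) (rename_enabling h E en)"
proof
  show "finite (h ` E)" using finite_events by simp
next
  fix b assume "b \<in> h ` E"
  then show "rename_enabling h E en b \<subseteq> Pow (h ` E)"
    using h en_subset by (fastforce simp: rename_enabling_image)
next
  fix b X Y
  assume b: "b \<in> h ` E" and X: "X \<in> rename_enabling h E en b"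
    and XY: "X \<subseteq> Y" and Y: "Y \<subseteq> h ` E"
  obtain e where e: "e \<in> E" "b = h e" using b by blast
  obtain Z where Z: "Z \<in> en e" "X = h ` Z"
    using X e h by (auto simp: rename_enabling_image)
  obtain W where W: "W \<subseteq> E" "Y = h ` W" using Y by (auto simp: subset_image_iff)
  have "Z \<subseteq> E" using Z e en_subset by blast
  then have "Z \<subseteq> W" using XY Z W h by (simp add: image_subset_image_iff_of_inj_on)
  then have "W \<in> en e" using en_upward e Z W by blast
  then show "Y \<in> rename_enabling h E en b"
    using W e h by (simp add: rename_enabling_image)
qed

lemma bij_betw_configurations_rename:
  assumes h: "inj_on h E"
  shows "bij_betw ((`) h) (configurations E en)
    (configurations (h ` E) (rename_enabling h E en))"
proof (rule bij_betw_imageI)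
  show "inj_on ((`) h) (configurations E en)"
    by (auto simp: configurations_def configuration_def
        inj_on_image_eq_iff[OF h] intro!: inj_onI)
next
  let ?en = "rename_enabling h E en" and ?g = "inv_into E h"
  have fwd: "configuration (h ` E) ?en (h ` X)" if "configuration E en X" for X
    using that by (rule configuration_image[rotated]) (simp add: rename_enabling_image[OF h])
  have bwd: "configuration E en (?g ` Y)" if "configuration (h ` E) ?en Y" for Y
  proof -
    have "(`) ?g ` ?en b \<subseteq> en (?g b)" if "b \<in> h ` E" for b
      using that by (auto simp: rename_enabling_image[OF h] inv_image_enabling[OF h] h)
    from configuration_image[of "h ` E" ?g ?en en, OF this that]
    show ?thesis using h by (simp add: inv_into_image_cancel)
  qed
  have "h ` ?g ` Y = Y" if "configuration (h ` E) ?en Y" for Y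
    using that by (simp add: configuration_def image_inv_into_cancel[OF refl])
  with fwd bwd
  show "(`) h ` configurations E en = configurations (h ` E) ?en"
    unfolding configurations_def by (auto simp: image_iff) metis
qed

lemma poset_isomorphic_rename:
  assumes h: "inj_on h E"
  shows "poset_isomorphic (configurations E en)
    (configurations (h ` E) (rename_enabling h E en))"
  unfolding poset_isomorphic_def
proof (intro exI conjI ballI)
  show "bij_betw ((`) h) (configurations E en)
      (configurations (h ` E) (rename_enabling h E en))"
    using h by (rule bij_betw_configurations_rename)
next
  fix X Y assume "X \<in> configurations E en" "Y \<in> configurations E en"
  then show "X \<subseteq> Y \<longleftrightarrow> h ` X \<subseteq> h ` Y"
    using image_subset_image_iff_of_inj_on[OF h] by (simp add: configurations_def configuration_def)
qed

end

theorem proposition5p14: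
  fixes E :: "'a set" and en :: "'a \<Rightarrow> 'a set set"
  assumes "cfes E en"
  shows "\<exists>(E' :: nat set) (en' :: nat \<Rightarrow> nat set set).
           dependency_event_structure E' en' \<and>
           poset_isomorphic (configurations E en) (configurations E' en')"
proof -
  interpret cfes E en by (fact assms)
  obtain h :: "'a \<Rightarrow> nat" where h: "inj_on h E"
    using finite_imp_inj_to_nat_seg[OF finite_events] by blast
  interpret numbered: cfes "h ` E" "rename_enabling h E en"
    using h by (rule cfes_rename)
  show ?thesis
    using numbered.dependency_reduct poset_isomorphic_rename[OF h]
    unfolding numbered.configurations_reduct[symmetric] by blast
qed

end
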